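(* Let $n=2$, $p_1=p$, $p_2=q$ with $p,q>0$, $p+q=1$, and let $t_2=-t_1$. For every integer $k\ge1$, the multinomial local-expansion coefficient $$c_k=\frac{(-1)^{k+1}}{k(k+1)}\Bigl[B_{k+1}-\sum_{i=1}^{2}p_i^{-k}B_{k+1}(t_i+1)\Bigr]$$ equals the binomial local-mass coefficient $A_k$, that is, $$c_k=A_k=\frac{(-1)^{k+1}}{k(k+1)}\Bigl[B_{k+1}-\bigl(p^{-k}+(-1)^{k+1}q^{-k}\bigr)B_{k+1}(t_1)\Bigr]+\frac{(-1)^k\,t_1^{\,k}}{k\,p^k}.$$
   Context: $B_k(x)$ are the Bernoulli polynomials and $B_k=B_k(0)$ the Bernoulli numbers (with $B_1=-\tfrac12$). For $X\sim\mathrm{Mult}(N;p_1,\dots,p_n)$ with $p_i>0$, $\sum_i p_i=1$, and a lattice point $m$ with $\sum_i m_i=N$, write $m_i=Np_i+t_i$ with the $t_i$ bounded, so that $\sum_i t_i=0$. The general coefficients $c_k=\frac{(-1)^{k+1}}{k(k+1)}\bigl[B_{k+1}-\sum_{i=1}^{n}p_i^{-k}B_{k+1}(t_i+1)\bigr]$ are those in the asymptotic expansion, as $N\to\infty$, $\Pr\{X=m\}\sim(2\pi N)^{-(n-1)/2}(p_1\cdots p_n)^{-1/2}\exp\bigl(\sum_{k\ge1}c_kN^{-k}\bigr)$. The binomial local-mass coefficients $A_k$ are the log-coefficients in the corresponding expansion of the binomial probability mass near its mean: for integer $m_1=Np+t_1$ with $t_1$ bounded, $\binom{N}{m_1}p^{m_1}q^{N-m_1}\sim(2\pi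 Npq)^{-1/2}\exp\bigl(\sum_{k\ge1}A_kN^{-k}\bigr)$. *)

theory Defs
  imports
    "HOL-Analysis.Analysis"
    "HOL-Computational_Algebra.Computational_Algebra"
    "HOL-Library.Landau_Symbols"
begin

text \<open>Generating function: $z e^{xz} / (e^z - 1) = \sum_k B_k(x) z^k / k!$, as formal power series
  in $z$. The convention is $B_1 = B_1(0) = -1/2$.\<close>

definition bernpoly :: "nat \<Rightarrow> real \<Rightarrow> real" where
  "bernpoly k x = fact k * fps_nth (fps_X * fps_exp x / (fps_exp 1 - 1)) k"

definition bernoulli :: "nat \<Rightarrow> real" where
  "bernoulli k = bernpoly k 0"

definition multinomial_local_coeff ::
    "nat \<Rightarrow> (nat \<Rightarrow> real) \<Rightarrow> (nat \<Rightarrow> real) \<Rightarrow> nat \<Rightarrow> real" where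
  "multinomial_local_coeff n p t k =
     (-1) ^ (k + 1) / (real k * (real k + 1)) *
       (bernoulli (k + 1) - (\<Sum>i = 1..n. 1 / p i ^ k * bernpoly (k + 1) (t i + 1)))"

text \<open>
  The expansion
  $\binom{N}{m} p^m q^{N-m} \sim (2 \pi N p q)^{-1/2} \exp (\sum_{k \ge 1} A_k N^{-k})$
  for integers $m = Np + t$ with $t$ bounded. Since $t = m - Np$ generally varies with $N$, the
  coefficients $A_k$ are functions of $t$, and the expansion is required along every sequence
  $m(N)$ for which $m(N) - Np$ is bounded; this is the same as uniformity for $t$ in bounded sets.
  Such a sequence satisfies $0 \le m(N) \le N$ for all large $N$ when $0 < p < 1$, so neither the
  truncated subtraction nor the logarithm of zero occurs there.

  For a given $p$ only countably many values of $t$ occur, so the expansion alone does not determine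
  arbitrary functions $A_k$ of a real variable. The coefficients are therefore taken to
  be polynomials in $t$, and the expansion has at most one such family of coefficients, up to
  the unused value at index $0$.
\<close>

definition binomial_local_expansion :: "real \<Rightarrow> real \<Rightarrow> (nat \<Rightarrow> real poly) \<Rightarrow> bool" where
  "binomial_local_expansion p q A \<longleftrightarrow>
     (\<forall>m :: nat \<Rightarrow> nat. Bseq (\<lambda>N. real (m N) - real N * p) \<longrightarrow>
       (\<forall>K. (\<lambda>N. ln (sqrt (2 * pi * real N * p * q) *
                     (real (N choose m N) * p ^ m N * q ^ (N - m N)))
                - (\<Sum>k = 1..K. poly (A k) (real (m N) - real N * p) / real N ^ k))
            \<in> O(\<lambda>N. 1 / real N ^ (K + 1))))"

definition binomial_local_coeff :: "real \<Rightarrow> real \<Rightarrow> nat \<Rightarrow> real \<Rightarrow> real" where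
  "binomial_local_coeff p q k t =
     (THE a. \<exists>A. binomial_local_expansion p q A \<and> a = poly (A k) t)"

end

theory Submission
  imports
    Defs
    "HOL-Real_Asymp.Real_Asymp"
begin

text \<open>
  Bernoulli polynomials satisfy $B_{k+1}' = (k+1) B_k$, which makes the truncated shifted Stirling
  series $(x + t + \frac12) \ln x - x + \sum_{k \le K} (-1)^{k+1} B_{k+1}(t+1) / (k(k+1) x^k)$
  constant, up to $O(x^{-K-1})$, when $x$ and $t$ vary with $x + t$ fixed. Hence it suffices to know
  Stirling's series for $\ln n!$ at $t = 0$. There the difference equation
  $B_{k+1}(x+1) - B_{k+1}(x) = (k+1) x^k$ reproduces the Taylor series of $\ln(1 + 1/n)$, so the error
  has summable increments, and Wallis' product identifies its limit.

  Applying this to $N!$, $m!$ and $(N-m)!$ gives the multinomial coefficients for $n = 2$. They are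
  polynomials in $t$, and such coefficients are unique because $m = \lfloor Np \rfloor + j + 1$ keeps
  $t$ in $[j, j+1]$, so that the difference of two candidates has a zero in every such interval. The
  closed form follows from the difference equation and from $B_k(1-x) = (-1)^k B_k(x)$.
\<close>

section \<open>Bernoulli polynomials\<close>

abbreviation bern_gf :: "real \<Rightarrow> real fps" where
  "bern_gf x \<equiv> fps_X * fps_exp x / (fps_exp 1 - 1)"

text \<open>The denominator has zero constant term, so it is not a unit. Since its subdegree is
  exactly 1, the division in the generating function is nevertheless exact, which is what
  \<open>bern_gf_mult\<close> needs.\<close>

lemma fps_exp_minus_one_dvd_X: "(fps_exp 1 - 1 :: real fps) dvd fps_X"
proof -
  have "subdegree (fps_exp 1 - 1 :: real fps) = 1"
    by (rule subdegreeI) auto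
  moreover from this have "(fps_exp 1 - 1 :: real fps) \<noteq> 0"
    by auto
  ultimately show ?thesis
    by (simp add: fps_dvd_iff)
qed

lemma fps_exp_minus_one_nonzero: "(fps_exp 1 - 1 :: real fps) \<noteq> 0"
  using fps_exp_minus_one_dvd_X by auto

lemma bern_gf_mult: "bern_gf x * (fps_exp 1 - 1) = fps_X * fps_exp x"
  by (rule dvd_div_mult_self) (simp add: fps_exp_minus_one_dvd_X)

text \<open>Cancellation of the nonzero factor \<open>fps_exp 1 - 1\<close>. The identities below
  are proved by multiplying out this factor, so that no division of series has to be
  computed.\<close>

lemma bern_gf_eqI:
  assumes "F * (fps_exp 1 - 1) = fps_X * fps_exp x"
  shows "F = bern_gf x"
  using assms bern_gf_mult[of x] fps_exp_minus_one_nonzero mult_right_cancel by metis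

text \<open>Cauchy product for \<open>bern_gf x = bern_gf 0 * fps_exp x\<close>. It exhibits
  \<open>bernpoly k\<close> as a polynomial in \<open>x\<close>.\<close>

lemma bernpoly_sum:
  "bernpoly k x = fact k * (\<Sum>i=0..k. fps_nth (bern_gf 0) i * (x ^ (k - i) / fact (k - i)))"
proof -
  have "bern_gf 0 * fps_exp x * (fps_exp 1 - 1) = fps_X * fps_exp x"
    using bern_gf_mult[of 0] by (metis (no_types) fps_exp_0 mult.assoc mult.commute mult.right_neutral)
  then have "bern_gf x = bern_gf 0 * fps_exp x"
    by (metis bern_gf_eqI)
  then show ?thesis
    unfolding bernpoly_def by (simp add: fps_mult_nth)
qed

text \<open>Compare coefficients in z e^((x+1)z) = z e^(xz) + z e^(xz) (e^z - 1), divided by e^z -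
  1.\<close>

lemma bernpoly_add_one: "bernpoly (Suc k) (x + 1) = bernpoly (Suc k) x + real (Suc k) * x ^ k"
proof -
  have "(bern_gf x + fps_X * fps_exp x) * (fps_exp 1 - 1) = fps_X * fps_exp (x + 1)"
    unfolding distrib_right bern_gf_mult fps_exp_add_mult by (simp add: algebra_simps)
  then have "bern_gf (x + 1) = bern_gf x + fps_X * fps_exp x"
    by (metis bern_gf_eqI)
  then show ?thesis
    unfolding bernpoly_def by (simp add: field_simps)
qed

text \<open>Substituting -z for z in the generating function and multiplying numerator and
  denominator by e^z turns the parameter \<open>x\<close> into \<open>1 - x\<close>, while the k-th
  coefficient picks up the sign (-1)^k.\<close>

lemma bernpoly_reflect: "bernpoly k (1 - x) = (-1) ^ k * bernpoly k x"
proof -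
  define F where "F = bern_gf x oo (fps_const (-1) * fps_X)"
  have neg: "fps_const (-1) * fps_X = (- fps_X :: real fps)"
    by (simp only: fps_const_neg [symmetric] fps_const_1_eq_1) simp
  have "(bern_gf x * (fps_exp 1 - 1)) oo (fps_const (-1) * fps_X) =
      (fps_X * fps_exp x) oo (fps_const (-1) * fps_X)"
    by (simp only: bern_gf_mult)
  then have "F * (fps_exp (-1) - 1) = - fps_X * fps_exp (- x)"
    unfolding F_def
    by (simp add: fps_compose_mult_distrib fps_compose_sub_distrib neg
        del: fps_const_neg)
  then have "F * (fps_exp (-1) - 1) * fps_exp 1 = - fps_X * (fps_exp (- x) * fps_exp 1)"
    by (simp only: mult.assoc)
  moreover have "fps_exp (-1) * fps_exp 1 = (1 :: real fps)"
    by (simp flip: fps_exp_add_mult)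
  moreover have "fps_exp (- x) * fps_exp 1 = fps_exp (1 - x)"
    by (simp flip: fps_exp_add_mult)
  ultimately have "F * (fps_exp 1 - 1) = fps_X * fps_exp (1 - x)"
    by (simp add: algebra_simps)
  then have "bern_gf (1 - x) = F"
    by (metis bern_gf_eqI)
  then show ?thesis
    unfolding bernpoly_def F_def by (simp only: fps_nth_compose_linear) simp
qed

text \<open>B_1 is linear with slope B_0, and the difference equation says that it grows by 1 over a
  unit step.\<close>

lemma bernpoly_0 [simp]: "bernpoly 0 x = 1"
  using bernpoly_add_one[of 0 x]
  by (simp add: bernpoly_sum distrib_left)

text \<open>The slope is known, and the antisymmetry of B_1 about 1/2 fixes the constant
  term.\<close>

lemma bernpoly_1: "bernpoly (Suc 0) x = x - 1 / 2"
proof -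
  have "bernpoly (Suc 0) x = x + fps_nth (bern_gf 0) 1" for x
    using bernpoly_0[of x] by (simp add: bernpoly_sum)
  then show ?thesis
    using bernpoly_reflect[of "Suc 0" x] by (auto simp: algebra_simps)
qed

text \<open>The difference equation at 0, where \<open>0 ^ k\<close> vanishes. The case
  \<open>k = 0\<close> is excluded because B_1(1) = 1/2 differs from B_1 = -1/2.\<close>

lemma bernpoly_one: "k \<ge> 1 \<Longrightarrow> bernpoly (Suc k) 1 = bernoulli (Suc k)"
  using bernpoly_add_one[of k 0] by (simp add: bernoulli_def)

section \<open>Bernoulli polynomials as functions of their argument\<close>

lemma has_field_derivative_bernpoly [derivative_intros]:
  assumes "(f has_field_derivative f') (at x within S)"
  shows "((\<lambda>x. bernpoly (Suc k) (f x)) has_field_derivative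
    real (Suc k) * bernpoly k (f x) * f') (at x within S)"
proof -
  define h where "h = fps_nth (bern_gf 0)"
  have "((\<lambda>x. fact (Suc k) * (\<Sum>i=0..Suc k. h i * (x ^ (Suc k - i) / fact (Suc k - i))))
      has_field_derivative
      fact (Suc k) * (\<Sum>i=0..Suc k. h i * (real (Suc k - i) * x ^ (Suc k - i - 1) / fact (Suc k - i))))
      (at x)" for x
    by (intro DERIV_cmult DERIV_sum DERIV_cdivide) (rule derivative_eq_intros refl | simp)+
  \<comment> \<open>The summand at \<open>i = Suc k\<close> is the derivative of a constant and
    vanishes; in the others the factor \<open>Suc k - i\<close> cancels against the
    factorial.\<close>
  moreover have "fact (Suc k) * (\<Sum>i=0..Suc k. h i * (real (Suc k - i) * x ^ (Suc k - i - 1) / fact (Suc k - i)))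
      = real (Suc k) * (fact k * (\<Sum>i=0..k. h i * (x ^ (k - i) / fact (k - i))))" for x
  proof -
    have "h i * (real (Suc k - i) * x ^ (Suc k - i - 1) / fact (Suc k - i)) =
        h i * (x ^ (k - i) / fact (k - i))" if "i \<le> k" for i
      using that by (simp add: Suc_diff_le field_simps del: of_nat_Suc)
    then have "(\<Sum>i=0..k. h i * (real (Suc k - i) * x ^ (Suc k - i - 1) / fact (Suc k - i))) =
        (\<Sum>i=0..k. h i * (x ^ (k - i) / fact (k - i)))"
      by (intro sum.cong) auto
    then show ?thesis
      by (simp add: algebra_simps del: of_nat_Suc diff_Suc_1)
  qed
  ultimately have "(bernpoly (Suc k) has_field_derivative real (Suc k) * bernpoly k x) (at x)" for x
    unfolding bernpoly_sum[abs_def] h_def[symmetric] by (simp only:)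
  from DERIV_chain2[OF this assms] show ?thesis .
qed

lemma continuous_on_bernpoly: "continuous_on S (bernpoly k)"
  unfolding bernpoly_sum[abs_def] by (intro continuous_intros) auto

text \<open>The Bernoulli polynomial as a formal object, since
  \<open>binomial_local_expansion\<close> takes its coefficients in
  \<open>real poly\<close>.\<close>

definition bern_poly :: "nat \<Rightarrow> real poly" where
  "bern_poly k = (\<Sum>i=0..k. monom (fact k * fps_nth (bern_gf 0) i / fact (k - i)) (k - i))"

lemma poly_bern_poly: "poly (bern_poly k) x = bernpoly k x"
  by (simp add: bern_poly_def bernpoly_sum poly_sum poly_monom sum_distrib_left mult.assoc)

section \<open>The truncated Stirling series\<close>

text \<open>The asymptotic series of ln Gamma(x + t + 1) for large \<open>x\<close> and bounded
  \<open>t\<close>, cut off at order \<open>K\<close> and without the constant ln(2 pi)/2.\<close>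

definition stirling_series :: "nat \<Rightarrow> real \<Rightarrow> real \<Rightarrow> real" where
  "stirling_series K x t = (x + t + 1 / 2) * ln x - x +
     (\<Sum>k=1..K. (-1) ^ (k + 1) * bernpoly (k + 1) (t + 1) / (real k * (real k + 1) * x ^ k))"

text \<open>Since $B_{k+1}' = (k+1) B_k$, the sum telescopes along lines on which $x + t$ is constant.\<close>

lemma stirling_series_derivative:
  assumes "x + s > 0"
  shows "((\<lambda>s. stirling_series K (x + s) (t - s)) has_field_derivative
    (-1) ^ K * bernpoly (Suc K) (t - s + 1) / ((real K + 1) * (x + s) ^ Suc K)) (at s)"
proof (induction K)
  case 0
  have "((\<lambda>s. (x + t + 1 / 2) * ln (x + s) - (x + s)) has_field_derivative
      (x + t + 1 / 2) / (x + s) - 1) (at s)"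
    using assms by (auto intro!: derivative_eq_intros)
  also have "(\<lambda>s. (x + t + 1 / 2) * ln (x + s) - (x + s)) =
      (\<lambda>s. stirling_series 0 (x + s) (t - s))"
    by (simp add: stirling_series_def fun_eq_iff)
  \<comment> \<open>The left side is (t - s + 1/2)/(x + s), and its numerator is B_1(t - s +
    1).\<close>
  also have "(x + t + 1 / 2) / (x + s) - 1 =
      (-1) ^ 0 * bernpoly (Suc 0) (t - s + 1) / ((real 0 + 1) * (x + s) ^ Suc 0)"
    using assms by (simp add: bernpoly_1 field_simps)
  finally show ?case .
next
  case (Suc K)
  have "((\<lambda>s. bernpoly (Suc (Suc K)) (t - s + 1)) has_field_derivative
      real (Suc (Suc K)) * bernpoly (Suc K) (t - s + 1) * (-1)) (at s)"
    by (intro derivative_eq_intros) (auto intro!: derivative_eq_intros)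
  moreover have "((\<lambda>s. inverse ((x + s) ^ Suc K)) has_field_derivative
      - (real (Suc K) / (x + s) ^ Suc (Suc K))) (at s)"
  proof -
    have "((\<lambda>s. (x + s) ^ Suc K) has_field_derivative real (Suc K) * (x + s) ^ K) (at s)"
      by (rule derivative_eq_intros refl | simp)+
    from DERIV_inverse_fun[OF this] show ?thesis
      using assms by (simp add: divide_simps del: of_nat_Suc)
  qed
  ultimately have "((\<lambda>s. (-1) ^ Suc (Suc K) / (real (Suc K) * (real (Suc K) + 1)) *
       (bernpoly (Suc (Suc K)) (t - s + 1) * inverse ((x + s) ^ Suc K))) has_field_derivative
      (-1) ^ Suc (Suc K) / (real (Suc K) * (real (Suc K) + 1)) *
        (real (Suc (Suc K)) * bernpoly (Suc K) (t - s + 1) * (-1) * inverse ((x + s) ^ Suc K) +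
         - (real (Suc K) / (x + s) ^ Suc (Suc K)) * bernpoly (Suc (Suc K)) (t - s + 1))) (at s)"
    by (intro DERIV_cmult DERIV_mult)
  note DERIV_add[OF Suc this]
  moreover have "stirling_series (Suc K) (x + s) (t - s) = stirling_series K (x + s) (t - s) +
      (-1) ^ Suc (Suc K) / (real (Suc K) * (real (Suc K) + 1)) *
       (bernpoly (Suc (Suc K)) (t - s + 1) * inverse ((x + s) ^ Suc K))" for s
  proof -
    have "(\<Sum>k=1..Suc K. f k) = (\<Sum>k=1..K. f k) + f (Suc K)" for f :: "nat \<Rightarrow> real"
      by simp
    moreover have "e * b / (c * d * y) = e / (c * d) * (b * inverse y)" for e b c d y :: real
      by (simp add: divide_inverse)
    ultimately show ?thesis
      unfolding stirling_series_def by (simp only: Suc_eq_plus1 add.assoc)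
  qed
  \<comment> \<open>Differentiating the Bernoulli factor of the new summand cancels the derivative
    at order \<open>K\<close>; differentiating its inverse power leaves the derivative at order
    \<open>Suc K\<close>.\<close>
  moreover have "(-1) ^ K * bernpoly (Suc K) (t - s + 1) / ((real K + 1) * (x + s) ^ Suc K) +
      (-1) ^ Suc (Suc K) / (real (Suc K) * (real (Suc K) + 1)) *
        (real (Suc (Suc K)) * bernpoly (Suc K) (t - s + 1) * (-1) * inverse ((x + s) ^ Suc K) +
         - (real (Suc K) / (x + s) ^ Suc (Suc K)) * bernpoly (Suc (Suc K)) (t - s + 1)) =
      (-1) ^ Suc K * bernpoly (Suc (Suc K)) (t - s + 1) / ((real (Suc K) + 1) * (x + s) ^ Suc (Suc K))"
  proof -
    have cancel: "e * b / (k * y) + e / (k * (k + 1)) * ((k + 1) * b * (-1) * inverse y + - (k / z) * c)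
        = - e * c / ((k + 1) * z)" if "k > 0" "y \<noteq> 0" "z \<noteq> 0" for e b k y z c :: real
    proof -
      have "k + 1 \<noteq> 0"
        using that by simp
      then have "e / (k * (k + 1)) * ((k + 1) * b * (-1) * inverse y) = - (e * b / (k * y))"
        "e / (k * (k + 1)) * (- (k / z) * c) = - e * c / ((k + 1) * z)"
        using that by (simp_all add: divide_simps)
      then show ?thesis
        by (simp only: distrib_left)
    qed
    show ?thesis
      using cancel[of "real (Suc K)" "(x + s) ^ Suc K" "(x + s) ^ Suc (Suc K)" "(-1) ^ K"] assms
      by (simp only: of_nat_Suc power_Suc) (simp add: add.commute)
  qed
  ultimately show ?case
    by simp
qed

text \<open>Mean value inequality for \<open>s\<close> running from 0 to \<open>t\<close> along the
  line of constant sum: the derivative has order x^(-K-1) uniformly, because the Bernoulli factor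
  stays bounded and \<open>x + s\<close> is comparable to \<open>x\<close>.\<close>

lemma stirling_series_shift:
  assumes "T > 0"
  obtains C where "\<And>x t. x \<ge> 2 * T \<Longrightarrow> \<bar>t\<bar> \<le> T \<Longrightarrow>
    \<bar>stirling_series K (x + t) 0 - stirling_series K x t\<bar> \<le> C / x ^ Suc K"
proof -
  \<comment> \<open>This interval contains every \<open>t - s + 1\<close> with \<open>t\<close> and
    \<open>s\<close> in [-T, T].\<close>
  have "compact (bernpoly (Suc K) ` {- 2 * T + 1..2 * T + 1})"
    by (intro compact_continuous_image continuous_on_bernpoly) auto
  then obtain B where "\<forall>u\<in>{- 2 * T + 1..2 * T + 1}. \<bar>bernpoly (Suc K) u\<bar> \<le> B"
    unfolding compact_eq_bounded_closed bounded_iff by auto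
  then have B: "\<bar>bernpoly (Suc K) u\<bar> \<le> B" if "u \<in> {- 2 * T + 1..2 * T + 1}" for u
    using that by blast
  have "B \<ge> 0"
    using B[of 1] assms by auto
  have "\<bar>stirling_series K (x + t) 0 - stirling_series K x t\<bar> \<le> B * 2 ^ Suc K * T / x ^ Suc K"
    if x: "x \<ge> 2 * T" and t: "\<bar>t\<bar> \<le> T" for x t
  proof -
    have "norm (stirling_series K (x + t) (t - t) - stirling_series K (x + 0) (t - 0))
        \<le> B / (x / 2) ^ Suc K * norm (t - 0)"
    proof (rule field_differentiable_bound[where S = "{-T..T}"])
      fix s assume s: "s \<in> {-T..T}"
      then have xs: "x / 2 \<le> x + s" "x + s > 0"
        using x assms by auto
      show "((\<lambda>s. stirling_series K (x + s) (t - s)) has_field_derivative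
          (-1) ^ K * bernpoly (Suc K) (t - s + 1) / ((real K + 1) * (x + s) ^ Suc K))
          (at s within {-T..T})"
        by (rule has_field_derivative_at_within[OF stirling_series_derivative[OF xs(2)]])
      have "1 * (x / 2) ^ Suc K \<le> (real K + 1) * (x + s) ^ Suc K"
        using xs x assms by (intro mult_mono power_mono) auto
      moreover have "\<bar>bernpoly (Suc K) (t - s + 1)\<bar> \<le> B"
        using s t by (intro B) auto
      ultimately have "\<bar>bernpoly (Suc K) (t - s + 1)\<bar> / ((real K + 1) * (x + s) ^ Suc K)
          \<le> B / (x / 2) ^ Suc K"
        using xs x assms \<open>B \<ge> 0\<close> by (intro frac_le) auto
      then show "norm ((-1) ^ K * bernpoly (Suc K) (t - s + 1) / ((real K + 1) * (x + s) ^ Suc K))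
          \<le> B / (x / 2) ^ Suc K"
        using xs by (simp add: abs_mult power_abs)
    qed (use t assms in auto)
    also have "\<dots> \<le> B / (x / 2) ^ Suc K * T"
      using t x assms \<open>B \<ge> 0\<close> by (intro mult_left_mono) auto
    finally show ?thesis
      by (simp add: power_divide)
  qed
  then show thesis
    by (rule that)
qed

section \<open>Stirling's series at the integers: increments of the error\<close>

text \<open>By the finite geometric series the remainder has derivative
  \<open>(-v) ^ K / (1 + v)\<close>, which is at most \<open>u ^ K\<close> in absolute value on
  [0, u].\<close>

lemma ln_one_plus_taylor_bound:
  fixes u :: real
  assumes "u \<ge> 0"
  shows "\<bar>ln (1 + u) - (\<Sum>k=1..K. (-1) ^ (k + 1) * u ^ k / real k)\<bar> \<le> u ^ Suc K"
proof -
  have "norm ((ln (1 + u) - (\<Sum>k=1..K. (-1) ^ (k + 1) * u ^ k / real k)) -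
      (ln (1 + 0) - (\<Sum>k=1..K. (-1) ^ (k + 1) * 0 ^ k / real k))) \<le> u ^ K * norm (u - 0)"
  proof (rule field_differentiable_bound[where S = "{0..u}"])
    fix v assume v: "v \<in> {0..u}"
    have "((\<lambda>v. ln (1 + v) - (\<Sum>k=1..K. (-1) ^ (k + 1) * v ^ k / real k)) has_field_derivative
        (-v) ^ K / (1 + v)) (at v)"
    proof (induction K)
      case 0
      then show ?case
        using v by (auto intro!: derivative_eq_intros)
    next
      case (Suc K)
      have "((\<lambda>v. (-1) ^ (Suc K + 1) * v ^ Suc K / real (Suc K)) has_field_derivative
         (-v) ^ K) (at v)"
        using DERIV_cmult[OF DERIV_pow[of "Suc K" v], of "(-1) ^ (Suc K + 1) / real (Suc K)"]
        by (simp add: power_minus[of v] del: of_nat_Suc)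
      note DERIV_diff[OF Suc this]
      moreover have "(-v) ^ K / (1 + v) - (-v) ^ K = (-v) ^ Suc K / (1 + v)"
        using v by (simp add: field_simps)
      ultimately show ?case
        by (simp add: diff_diff_add)
    qed
    then show "((\<lambda>v. ln (1 + v) - (\<Sum>k=1..K. (-1) ^ (k + 1) * v ^ k / real k)) has_field_derivative
        (-v) ^ K / (1 + v)) (at v within {0..u})"
      by (rule has_field_derivative_at_within)
    have "v ^ K / (1 + v) \<le> u ^ K / 1"
      using v by (intro frac_le power_mono) auto
    then show "norm ((-v) ^ K / (1 + v)) \<le> u ^ K"
      using v by (simp add: power_abs)
  qed (use assms in auto)
  moreover have "(\<Sum>k=1..K. (-1) ^ (k + 1) * 0 ^ k / real k) = (0 :: real)"
    by (intro sum.neutral) auto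
  ultimately show ?thesis
    using assms by (simp add: mult.commute)
qed

text \<open>Going from \<open>n\<close> to \<open>n + 1\<close> passes through the series at
  \<open>n\<close> with shift 1. Its distance from the series at \<open>n + 1\<close> is a shift
  error, and it exceeds the series at \<open>n\<close> by ln n plus a Taylor polynomial of ln(1 +
  1/n), which matches ln(n + 1).\<close>

lemma stirling_series_Suc_bound:
  obtains C where "\<And>n. n \<ge> 2 \<Longrightarrow>
    \<bar>(ln (fact (Suc n)) - stirling_series K (real (Suc n)) 0) -
      (ln (fact n) - stirling_series K (real n) 0)\<bar> \<le> C / real n ^ Suc K"
proof -
  obtain C where C: "\<And>x t. x \<ge> 2 * 1 \<Longrightarrow> \<bar>t\<bar> \<le> 1 \<Longrightarrow>
      \<bar>stirling_series K (x + t) 0 - stirling_series K x t\<bar> \<le> C / x ^ Suc K"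
    using stirling_series_shift[of 1] by auto
  have "\<bar>(ln (fact (Suc n)) - stirling_series K (real (Suc n)) 0) -
      (ln (fact n) - stirling_series K (real n) 0)\<bar> \<le> (C + 1) / real n ^ Suc K" if n: "n \<ge> 2" for n
  proof -
    define S where "S = (\<Sum>k=1..K. (-1) ^ (k + 1) * (1 / real n) ^ k / real k)"
    \<comment> \<open>The increment k + 1 cancels a factor of the denominator k(k + 1), leaving the
      Taylor coefficient 1/k up to sign.\<close>
    have "bernpoly (k + 1) 2 = bernpoly (k + 1) 1 + (real k + 1)" for k
      using bernpoly_add_one[of k 1] by simp
    then have "(-1) ^ (k + 1) * bernpoly (k + 1) (1 + 1) / (real k * (real k + 1) * real n ^ k) =
        (-1) ^ (k + 1) * bernpoly (k + 1) (0 + 1) / (real k * (real k + 1) * real n ^ k) +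
        (-1) ^ (k + 1) * (1 / real n) ^ k / real k" for k
    proof -
      have "a * (b + d) / (c * d * e) = a * b / (c * d * e) + a * (1 / e) / c" if "d > 0"
        for a b c d e :: real
        using that by (cases "c = 0"; cases "e = 0") (simp_all add: field_simps)
      then show ?thesis
        using \<open>bernpoly (k + 1) 2 = _\<close> by (simp add: power_divide)
    qed
    then have "stirling_series K (real n) 1 = stirling_series K (real n) 0 + ln (real n) + S"
      unfolding stirling_series_def S_def by (simp only: sum.distrib) (simp add: algebra_simps)
    moreover have "ln (fact (Suc n)) = ln (fact n :: real) + ln (real n) + ln (1 + 1 / real n)"
    proof -
      have "fact (Suc n) = fact n * (real n * (1 + 1 / real n))"
        using n by (simp add: field_simps)
      moreover have "ln (a * (b * c)) = ln a + ln b + ln c" if "a > 0" "b > 0" "c > 0"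
        for a b c :: real
        using that by (simp add: ln_mult)
      moreover have "1 + 1 / real n > 0"
        by (simp add: add_pos_nonneg)
      ultimately show ?thesis
        using n by (simp only: fact_gt_zero)
    qed
    moreover have "\<bar>ln (1 + 1 / real n) - S\<bar> \<le> (1 / real n) ^ Suc K"
      unfolding S_def by (rule ln_one_plus_taylor_bound) auto
    moreover have "\<bar>stirling_series K (real n + 1) 0 - stirling_series K (real n) 1\<bar>
        \<le> C / real n ^ Suc K"
      using n by (intro C) auto
    ultimately show ?thesis
      by (simp add: add_divide_distrib power_divide add.commute)
  qed
  then show thesis
    by (rule that)
qed

text \<open>Bound i^(-K-2) by n^(-K) i^(-2) for i >= n, and i^(-2) by twice the telescoping
  difference 1/i - 1/(i + 1). Summation costs one power of \<open>n\<close>.\<close>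

lemma telescoping_tail_bound:
  fixes a :: "nat \<Rightarrow> real"
  assumes step: "\<And>n. n \<ge> M \<Longrightarrow> \<bar>a (Suc n) - a n\<bar> \<le> C / real n ^ Suc (Suc K)"
    and "M \<ge> 1" "M \<le> n" "n \<le> j"
  shows "\<bar>a j - a n\<bar> \<le> 2 * C / real n ^ Suc K"
proof -
  \<comment> \<open>Nonnegativity of \<open>C\<close> is forced by the hypothesis at
    \<open>n = M\<close>, since it bounds an absolute value there.\<close>
  have "0 \<le> C / real M ^ Suc (Suc K)"
    using step[of M] by (meson abs_ge_zero order.refl order.trans)
  moreover have "real M ^ Suc (Suc K) > 0"
    using \<open>M \<ge> 1\<close> by simp
  ultimately have C: "C \<ge> 0"
    by (meson divide_neg_pos not_le)
  have n: "n \<ge> 1"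
    using assms by simp
  have "\<bar>a j - a n\<bar> \<le> 2 * C / real n ^ K * (1 / real n - 1 / real j)"
    using \<open>n \<le> j\<close>
  proof (induction j rule: dec_induct)
    case base
    then show ?case by simp
  next
    case (step i)
    have "1 / real i ^ 2 \<le> 2 * (1 / real i - 1 / real (Suc i))"
      using step.hyps n by (simp add: divide_simps power2_eq_square)
    moreover have "1 / real i ^ K \<le> 1 / real n ^ K"
      using step.hyps n by (intro divide_left_mono power_mono) auto
    ultimately have "C * ((1 / real i ^ K) * (1 / real i ^ 2)) \<le>
        C * ((1 / real n ^ K) * (2 * (1 / real i - 1 / real (Suc i))))"
      using C by (intro mult_left_mono mult_mono) auto
    moreover have "C * ((1 / real i ^ K) * (1 / real i ^ 2)) = C / real i ^ Suc (Suc K)"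
      by (simp add: power2_eq_square)
    ultimately have "\<bar>a (Suc i) - a i\<bar> \<le> C * ((1 / real n ^ K) * (2 * (1 / real i - 1 / real (Suc i))))"
      using assms(1)[of i] step.hyps \<open>M \<le> n\<close> by linarith
    also have "\<dots> = 2 * C / real n ^ K * (1 / real i - 1 / real (Suc i))"
      by simp
    finally show ?case
      using step.IH unfolding right_diff_distrib by linarith
  qed
  also have "\<dots> \<le> 2 * C / real n ^ K * (1 / real n)"
    using C by (intro mult_left_mono) auto
  also have "\<dots> = 2 * C / real n ^ Suc K"
    by simp
  finally show ?thesis .
qed

section \<open>The limit of the error and Wallis' product\<close>

lemma stirling_series_Suc_order:
  "stirling_series (Suc K) x 0 = stirling_series K x 0 +
    (-1) ^ K * bernpoly (K + 2) 1 / ((real K + 1) * (real K + 2)) / x ^ Suc K"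
  by (simp add: stirling_series_def algebra_simps)

text \<open>At order 1 the increments are O(1/n^2), so the errors form a Cauchy sequence. Errors of
  consecutive orders differ by a null sequence, so all orders share the same limit.\<close>

lemma ln_fact_stirling_limit:
  obtains L where "\<And>K. (\<lambda>n. ln (fact n) - stirling_series K (real n) 0) \<longlonglongrightarrow> L"
proof -
  define R where "R K n = ln (fact n) - stirling_series K (real n) 0" for K n
  obtain C where C: "\<And>n. n \<ge> 2 \<Longrightarrow> \<bar>R 1 (Suc n) - R 1 n\<bar> \<le> C / real n ^ Suc (Suc 0)"
    using stirling_series_Suc_bound[of 1] unfolding R_def by auto
  have tail: "\<bar>R 1 j - R 1 n\<bar> \<le> 2 * C / real n" if "2 \<le> n" "n \<le> j" for n j
    using telescoping_tail_bound[of 2 "R 1" C 0 n j, OF C] that by simp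
  have "Cauchy (R 1)"
  proof (rule metric_CauchyI)
    fix e :: real assume "e > 0"
    obtain M where M: "real M > 4 * \<bar>C\<bar> / e"
      using reals_Archimedean2 by blast
    define n where "n = M + 2"
    have "2 * C / real n < e / 2"
      using M \<open>e > 0\<close> unfolding n_def by (auto simp: field_simps abs_if split: if_splits)
    have "dist (R 1 i) (R 1 j) < e" if "i \<ge> n" "j \<ge> n" for i j
      using tail[of n i] tail[of n j] that \<open>2 * C / real n < e / 2\<close> unfolding n_def dist_real_def
      by linarith
    then show "\<exists>n. \<forall>i\<ge>n. \<forall>j\<ge>n. dist (R 1 i) (R 1 j) < e"
      by blast
  qed
  then obtain L where L: "R 1 \<longlonglongrightarrow> L"
    using Cauchy_convergent_iff convergent_def by blast
  have diff: "(\<lambda>n. R K n - R (Suc K) n) \<longlonglongrightarrow> 0" for K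
  proof -
    define c where "c = - ((-1) ^ K * bernpoly (K + 2) 1 / ((real K + 1) * (real K + 2)))"
    have "R K n - R (Suc K) n = - c / real n ^ Suc K" for n
      unfolding R_def stirling_series_Suc_order c_def by simp
    moreover have "(\<lambda>n. - c / real n ^ Suc K) \<longlonglongrightarrow> 0"
      by (intro real_tendsto_divide_at_top[OF tendsto_const] filterlim_pow_at_top
          filterlim_real_sequentially) auto
    ultimately show ?thesis
      by simp
  qed
  \<comment> \<open>Convergence is known at order 1; one step down gives order 0, from which the
    induction climbs to every order.\<close>
  have R0: "R 0 \<longlonglongrightarrow> L"
    using tendsto_add[OF diff[of 0]] L by fastforce
  have "R K \<longlonglongrightarrow> L" for K
  proof (induction K)
    case 0
    show ?case by (rule R0)
  next
    case (Suc K)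
    from tendsto_diff[OF this diff[of K]] show ?case
      by simp
  qed
  then have "(\<lambda>n. ln (fact n) - stirling_series K (real n) 0) \<longlonglongrightarrow> L" for K
    by (simp only: R_def[abs_def])
  then show thesis
    by (rule that)
qed

text \<open>After taking logarithms, this form brings in 4 ln n! - 2 ln (2n)!, to which the Stirling
  errors apply.\<close>

lemma wallis_product_fact:
  "(\<Prod>k=1..n. (4 * real k ^ 2) / (4 * real k ^ 2 - 1)) =
    2 ^ (4 * n) * fact n ^ 4 / (fact (2 * n) ^ 2 * (2 * real n + 1))"
proof (induction n)
  case (Suc n)
  \<comment> \<open>With these, the new factor is 4w^2/(uv) and (2n + 2)! = 2wu (2n)!, so the step
    becomes a rational identity.\<close>
  define u v w where "u = 2 * real n + 1" and "v = 2 * real n + 3" and "w = real n + 1"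
  have nz: "u \<noteq> 0" "v \<noteq> 0" "w \<noteq> 0"
    by (simp_all add: u_def v_def w_def add_eq_0_iff)
  have w: "real (Suc n) = w" and uv: "4 * w ^ 2 - 1 = u * v" and v: "2 * w + 1 = v"
    by (simp_all add: u_def v_def w_def power2_eq_square algebra_simps)
  have fact_w: "fact (Suc n) = w * fact n"
    and fact_u: "fact (2 * Suc n) = 2 * w * u * fact (2 * n)"
    by (simp_all add: u_def w_def algebra_simps)
  have pow: "(2::real) ^ (4 * Suc n) = 16 * 2 ^ (4 * n)"
    by (simp add: power_add)
  have "(\<Prod>k=1..Suc n. (4 * real k ^ 2) / (4 * real k ^ 2 - 1)) =
      2 ^ (4 * n) * fact n ^ 4 / (fact (2 * n) ^ 2 * u) * (4 * w ^ 2 / (u * v))"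
    using Suc.IH by (simp add: w uv u_def del: of_nat_Suc)
  also have "\<dots> = 16 * 2 ^ (4 * n) * (w * fact n) ^ 4 / ((2 * w * u * fact (2 * n))\<^sup>2 * v)"
  proof -
    have "P * F ^ 4 / (D\<^sup>2 * u) * (4 * w\<^sup>2 / (u * v)) =
        16 * P * (w * F) ^ 4 / ((2 * w * u * D)\<^sup>2 * v)" for P F D :: real
      using nz by (simp add: field_simps power2_eq_square power4_eq_xxxx)
    then show ?thesis .
  qed
  finally show ?case
    by (simp only: w v fact_w fact_u pow)
qed simp

text \<open>In \<open>4 * R n - 2 * R (2 * n)\<close> the terms n ln n and n cancel; corrected by
  ln(n/(2(2n + 1))) it is the logarithm of a Wallis product. Comparing limits gives 2L + ln(1/4) =
  ln(pi/2).\<close>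

theorem ln_fact_stirling_tendsto:
  "(\<lambda>n. ln (fact n) - stirling_series K (real n) 0) \<longlonglongrightarrow> ln (2 * pi) / 2"
proof -
  obtain L where L: "\<And>K. (\<lambda>n. ln (fact n) - stirling_series K (real n) 0) \<longlonglongrightarrow> L"
    using ln_fact_stirling_limit by blast
  define R where "R n = ln (fact n) - stirling_series 0 (real n) 0" for n
  have R: "R \<longlonglongrightarrow> L"
    using L[of 0] by (simp add: R_def[abs_def])
  have "(\<lambda>n. R (2 * n)) \<longlonglongrightarrow> L"
    using LIMSEQ_subseq_LIMSEQ[OF R, of "\<lambda>n. 2 * n"] by (simp add: strict_mono_def o_def)
  moreover have "(\<lambda>n. real n / (2 * (2 * real n + 1))) \<longlonglongrightarrow> 1 / 4"
    by real_asymp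
  then have "(\<lambda>n. ln (real n / (2 * (2 * real n + 1)))) \<longlonglongrightarrow> ln (1 / 4)"
    by (rule tendsto_ln) simp
  ultimately have "(\<lambda>n. 4 * R n - 2 * R (2 * n) + ln (real n / (2 * (2 * real n + 1))))
      \<longlonglongrightarrow> 4 * L - 2 * L + ln (1 / 4)"
    using R by (intro tendsto_add tendsto_diff tendsto_mult tendsto_const)
  moreover have "eventually (\<lambda>n. 4 * R n - 2 * R (2 * n) + ln (real n / (2 * (2 * real n + 1))) =
      ln (\<Prod>k=1..n. (4 * real k ^ 2) / (4 * real k ^ 2 - 1))) sequentially"
  proof (rule eventually_sequentiallyI[of 1])
    fix n :: nat assume n: "1 \<le> n"
    have "ln (2 ^ (4 * n) * fact n ^ 4 / (fact (2 * n) ^ 2 * (2 * real n + 1))) =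
        4 * real n * ln 2 + 4 * ln (fact n) - (2 * ln (fact (2 * n)) + ln (2 * real n + 1))"
      by (simp add: ln_div ln_mult ln_realpow add_pos_pos)
    moreover have "ln (real n / (2 * (2 * real n + 1))) = ln (real n) - (ln 2 + ln (2 * real n + 1))"
    proof -
      have "ln (a / (2 * b)) = ln a - (ln 2 + ln b)" if "a > 0" "b > 0" for a b :: real
        using that by (simp add: ln_div ln_mult)
      from this[of "real n" "2 * real n + 1"] show ?thesis
        using n by simp
    qed
    moreover have "ln (real (2 * n)) = ln 2 + ln (real n)"
      using n by (simp add: ln_mult)
    ultimately show "4 * R n - 2 * R (2 * n) + ln (real n / (2 * (2 * real n + 1))) =
        ln (\<Prod>k=1..n. (4 * real k ^ 2) / (4 * real k ^ 2 - 1))"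
      unfolding R_def stirling_series_def wallis_product_fact by (simp add: algebra_simps)
  qed
  ultimately have "(\<lambda>n. ln (\<Prod>k=1..n. (4 * real k ^ 2) / (4 * real k ^ 2 - 1)))
      \<longlonglongrightarrow> 4 * L - 2 * L + ln (1 / 4)"
    by (rule Lim_transform_eventually)
  moreover have "(\<lambda>n. ln (\<Prod>k=1..n. (4 * real k ^ 2) / (4 * real k ^ 2 - 1))) \<longlonglongrightarrow> ln (pi / 2)"
    by (rule tendsto_ln[OF wallis]) simp
  ultimately have "4 * L - 2 * L + ln (1 / 4) = ln (pi / 2)"
    by (rule LIMSEQ_unique)
  moreover have "ln (pi / 2) = ln (2 * pi) + ln (1 / 4)"
    using ln_mult[of "2 * pi" "1 / 4"] by simp
  ultimately have "L = ln (2 * pi) / 2"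
    by simp
  then show ?thesis
    using L by blast
qed

section \<open>Stirling's series with an error rate\<close>

text \<open>One order more is used than is claimed: at order \<open>Suc K\<close> the increments are
  O(n^(-K-2)), with tails O(n^(-K-1)), and the extra summand that is then dropped has this size as
  well.\<close>

lemma ln_fact_stirling_bound:
  obtains C where "\<And>n. n \<ge> 2 \<Longrightarrow>
    \<bar>ln (fact n) - stirling_series K (real n) 0 - ln (2 * pi) / 2\<bar> \<le> C / real n ^ Suc K"
proof -
  define R where "R n = ln (fact n) - stirling_series (Suc K) (real n) 0" for n
  define c where "c = (-1) ^ K * bernpoly (K + 2) 1 / ((real K + 1) * (real K + 2))"
  obtain C where C: "\<And>n. n \<ge> 2 \<Longrightarrow> \<bar>R (Suc n) - R n\<bar> \<le> C / real n ^ Suc (Suc K)"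
    using stirling_series_Suc_bound[of "Suc K"] unfolding R_def by auto
  have "\<bar>ln (fact n) - stirling_series K (real n) 0 - ln (2 * pi) / 2\<bar> \<le> (2 * C + \<bar>c\<bar>) / real n ^ Suc K"
    if n: "n \<ge> 2" for n
  proof -
    have "R \<longlonglongrightarrow> ln (2 * pi) / 2"
      unfolding R_def by (rule ln_fact_stirling_tendsto)
    \<comment> \<open>Letting \<open>j\<close> tend to infinity in the tail bound replaces
      \<open>R j\<close> by its limit.\<close>
    then have "(\<lambda>j. \<bar>R j - R n\<bar>) \<longlonglongrightarrow> \<bar>ln (2 * pi) / 2 - R n\<bar>"
      by (intro tendsto_intros)
    moreover have "\<forall>j\<ge>n. \<bar>R j - R n\<bar> \<le> 2 * C / real n ^ Suc K"
      using telescoping_tail_bound[of 2 R C K n, OF C] n by auto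
    ultimately have "\<bar>ln (2 * pi) / 2 - R n\<bar> \<le> 2 * C / real n ^ Suc K"
      by (intro LIMSEQ_le_const2) auto
    moreover have "ln (fact n) - stirling_series K (real n) 0 = R n + c / real n ^ Suc K"
      by (simp add: R_def stirling_series_Suc_order c_def)
    moreover have "\<bar>c / real n ^ Suc K\<bar> = \<bar>c\<bar> / real n ^ Suc K"
      by simp
    ultimately show ?thesis
      unfolding add_divide_distrib by linarith
  qed
  then show thesis
    by (rule that)
qed

text \<open>Combines the bound at the integer \<open>m N\<close> with a bounded shift to the real
  centre \<open>x N\<close>, which will be \<open>N\<close>, \<open>N p\<close> or
  \<open>N q\<close>.\<close>

lemma ln_fact_shifted_stirling:
  assumes x: "filterlim x at_top sequentially"
    and m: "Bseq (\<lambda>N. real (m N) - x N)"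
  shows "(\<lambda>N. ln (fact (m N)) - stirling_series K (x N) (real (m N) - x N) - ln (2 * pi) / 2)
    \<in> O(\<lambda>N. 1 / x N ^ Suc K)"
proof -
  obtain T where T: "T > 0" "\<And>N. \<bar>real (m N) - x N\<bar> \<le> T"
    using m by (auto simp: Bseq_def)
  obtain C1 where C1: "\<And>n. n \<ge> 2 \<Longrightarrow>
      \<bar>ln (fact n) - stirling_series K (real n) 0 - ln (2 * pi) / 2\<bar> \<le> C1 / real n ^ Suc K"
    using ln_fact_stirling_bound[of K] by blast
  obtain C2 where C2: "\<And>x t. x \<ge> 2 * T \<Longrightarrow> \<bar>t\<bar> \<le> T \<Longrightarrow>
      \<bar>stirling_series K (x + t) 0 - stirling_series K x t\<bar> \<le> C2 / x ^ Suc K"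
    using stirling_series_shift[OF T(1), of K] by blast
  \<comment> \<open>The part \<open>2 * T\<close> permits the shift and keeps \<open>m N\<close>
    above half of \<open>x N\<close>; the added 4 ensures \<open>m N >= 2\<close>.\<close>
  have "eventually (\<lambda>N. x N \<ge> 2 * T + 4) sequentially"
    using x by (simp add: filterlim_at_top)
  then have "eventually (\<lambda>N. norm (ln (fact (m N)) - stirling_series K (x N) (real (m N) - x N) -
      ln (2 * pi) / 2) \<le> (\<bar>C1\<bar> * 2 ^ Suc K + C2) * norm (1 / x N ^ Suc K)) sequentially"
  proof eventually_elim
    case (elim N)
    have mN: "real (m N) \<ge> x N / 2" "real (m N) \<ge> 2"
      using T(2)[of N] elim T(1) by linarith+
    have xN: "x N > 0"
      using elim T(1) by linarith
    have "\<bar>ln (fact (m N)) - stirling_series K (real (m N)) 0 - ln (2 * pi) / 2\<bar> \<le>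
        C1 / real (m N) ^ Suc K"
      using mN by (intro C1) auto
    also have "\<dots> \<le> \<bar>C1\<bar> / (x N / 2) ^ Suc K"
      using mN xN by (intro frac_le power_mono) auto
    finally have "\<bar>ln (fact (m N)) - stirling_series K (real (m N)) 0 - ln (2 * pi) / 2\<bar> \<le>
        \<bar>C1\<bar> * 2 ^ Suc K / x N ^ Suc K"
      by (simp add: power_divide)
    moreover have "\<bar>stirling_series K (x N + (real (m N) - x N)) 0 -
        stirling_series K (x N) (real (m N) - x N)\<bar> \<le> C2 / x N ^ Suc K"
      using elim T by (intro C2) auto
    ultimately have "\<bar>ln (fact (m N)) - stirling_series K (x N) (real (m N) - x N) - ln (2 * pi) / 2\<bar>
        \<le> (\<bar>C1\<bar> * 2 ^ Suc K + C2) / x N ^ Suc K"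
      unfolding add_divide_distrib by simp
    then show ?case
      using xN by simp
  qed
  then show ?thesis
    by (rule bigoI)
qed

section \<open>The binomial local expansion\<close>

text \<open>The multinomial coefficient c_k for two cells with shifts t and -t, as a polynomial in
  t. The two compositions substitute t + 1 and 1 - t.\<close>

definition binomial_local_poly :: "real \<Rightarrow> real \<Rightarrow> nat \<Rightarrow> real poly" where
  "binomial_local_poly p q k = smult ((-1) ^ (k + 1) / (real k * (real k + 1)))
     ([:bernoulli (k + 1):] -
       (smult (1 / p ^ k) (bern_poly (k + 1) \<circ>\<^sub>p [:1, 1:]) +
        smult (1 / q ^ k) (bern_poly (k + 1) \<circ>\<^sub>p [:1, -1:])))"

lemma poly_binomial_local_poly:
  "poly (binomial_local_poly p q k) t = (-1) ^ (k + 1) / (real k * (real k + 1)) *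
     (bernoulli (k + 1) -
       (1 / p ^ k * bernpoly (k + 1) (t + 1) + 1 / q ^ k * bernpoly (k + 1) (- t + 1)))"
proof -
  have "poly [:1, 1:] t = t + 1" "poly [:1, -1:] t = - t + 1"
    "poly [:bernoulli (k + 1):] t = bernoulli (k + 1)"
    by simp_all
  then show ?thesis
    by (simp only: binomial_local_poly_def poly_smult poly_diff poly_add poly_pcompose poly_bern_poly)
qed

lemma stirling_series_binomial:
  assumes "p > 0" "q > 0" "p + q = 1" "n > 0"
  shows "stirling_series K n 0 - stirling_series K (n * p) t - stirling_series K (n * q) (- t)
      - ln (2 * pi) / 2 =
    (\<Sum>k=1..K. poly (binomial_local_poly p q k) t / n ^ k) -
    (ln (2 * pi * n * p * q) / 2 + (n * p + t) * ln p + (n * q - t) * ln q)"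
proof -
  define e where "e k = (-1) ^ (k + 1) / (real k * (real k + 1))" for k :: nat
  define B where "B x u = (\<Sum>k=1..K. (-1) ^ (k + 1) * bernpoly (k + 1) (u + 1) /
    (real k * (real k + 1) * x ^ k))" for x u
  have "B n 0 - B (n * p) t - B (n * q) (- t) =
      (\<Sum>k=1..K. poly (binomial_local_poly p q k) t / n ^ k)"
    unfolding B_def sum_subtractf[symmetric]
  proof (rule sum.cong)
    fix k assume k: "k \<in> {1..K}"
    then have one: "bernpoly (k + 1) (0 + 1) = bernoulli (k + 1)"
      using bernpoly_one[of k] by simp
    have alg: "s * b / (d * y) - s * b1 / (d * (y * P)) - s * b2 / (d * (y * Q)) =
        s / d * (b - (1 / P * b1 + 1 / Q * b2)) / y" if "d > 0" "y > 0" "P > 0" "Q > 0"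
      for s d y P Q b b1 b2 :: real
      using that by (simp add: field_simps)
    show "(-1) ^ (k + 1) * bernpoly (k + 1) (0 + 1) / (real k * (real k + 1) * n ^ k) -
        (-1) ^ (k + 1) * bernpoly (k + 1) (t + 1) / (real k * (real k + 1) * (n * p) ^ k) -
        (-1) ^ (k + 1) * bernpoly (k + 1) (- t + 1) / (real k * (real k + 1) * (n * q) ^ k) =
        poly (binomial_local_poly p q k) t / n ^ k"
      unfolding poly_binomial_local_poly one power_mult_distrib
      by (rule alg) (use k assms in auto)
  qed auto
  moreover have "stirling_series K x u = (x + u + 1 / 2) * ln x - x + B x u" for x u
    by (simp add: stirling_series_def B_def)
  moreover have "ln (n * p) = ln n + ln p" "ln (n * q) = ln n + ln q"
    "ln (2 * pi * n * p * q) = ln (2 * pi) + ln n + ln p + ln q"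
    using assms by (simp_all add: ln_mult)
  \<comment> \<open>Because p + q = 1 and the shifts cancel, the linear terms vanish and ln n keeps
    only the coefficient -1/2, which goes into the square root.\<close>
  moreover have "(n + 0 + 1 / 2) * l - n + b0 - ((n * p + t + 1 / 2) * (l + lp) - n * p + b1) -
      ((n * q + - t + 1 / 2) * (l + lq) - n * q + b2) - c / 2 =
      b0 - b1 - b2 - ((c + l + lp + lq) / 2 + (n * p + t) * lp + (n * q - t) * lq)"
    for l lp lq b0 b1 b2 c
  proof -
    have "q = 1 - p"
      using assms by simp
    then show ?thesis
      by (simp only:) (simp add: field_simps)
  qed
  ultimately show ?thesis
    by (simp only:)
qed

theorem binomial_local_expansion_poly:
  assumes pq: "p > 0" "q > 0" "p + q = 1"
  shows "binomial_local_expansion p q (binomial_local_poly p q)"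
  unfolding binomial_local_expansion_def
proof (intro allI impI)
  fix m :: "nat \<Rightarrow> nat" and K :: nat
  assume m: "Bseq (\<lambda>N. real (m N) - real N * p)"
  define t where "t N = real (m N) - real N * p" for N
  define E where "E l x u = ln (fact l) - stirling_series K x u - ln (2 * pi) / 2"
    for l :: nat and x u
  obtain T where T: "\<And>N. \<bar>t N\<bar> \<le> T"
    using m by (auto simp: Bseq_def t_def)
  have "filterlim (\<lambda>N. real N * q) at_top sequentially"
    using pq by real_asymp
  then have "eventually (\<lambda>N. real N * q \<ge> T) sequentially"
    by (simp add: filterlim_at_top)
  \<comment> \<open>The deviation from \<open>N p\<close> is bounded while \<open>N q\<close> tends
    to infinity. From here on \<open>N - m N\<close> is an honest difference and its deviation from
    \<open>N q\<close> is \<open>- t N\<close>.\<close>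
  then have le: "eventually (\<lambda>N. m N \<le> N) sequentially"
  proof eventually_elim
    case (elim N)
    have "real N = real N * p + real N * q"
      using pq by (simp flip: distrib_left)
    then have "real (m N) \<le> real N"
      using T[of N] elim unfolding t_def by linarith
    then show ?case
      by simp
  qed
  have q: "q = 1 - p"
    using pq by simp
  have t': "eventually (\<lambda>N. real (N - m N) - real N * q = - t N) sequentially"
    using le by eventually_elim (simp add: t_def q of_nat_diff algebra_simps)
  have "Bseq (\<lambda>N. real (N - m N) - real N * q)"
  proof (rule Bseq_eventually_mono)
    show "eventually (\<lambda>N. norm (real (N - m N) - real N * q) \<le> norm (t N)) sequentially"
      using t' by eventually_elim simp
    show "Bseq t"
      using m by (simp add: t_def[abs_def])
  qed
  then have "(\<lambda>N. E (N - m N) (real N * q) (real (N - m N) - real N * q))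
      \<in> O(\<lambda>N. 1 / (real N * q) ^ Suc K)"
    unfolding E_def using pq by (intro ln_fact_shifted_stirling) real_asymp
  also have "(\<lambda>N. 1 / (real N * q) ^ Suc K) \<in> O(\<lambda>N. 1 / real N ^ Suc K)"
    by (rule bigoI[where c = "1 / q ^ Suc K"]) (use pq in \<open>simp add: power_mult_distrib mult_ac\<close>)
  finally have E2: "(\<lambda>N. E (N - m N) (real N * q) (real (N - m N) - real N * q))
      \<in> O(\<lambda>N. 1 / real N ^ Suc K)" .
  have "(\<lambda>N. E (m N) (real N * p) (t N)) \<in> O(\<lambda>N. 1 / (real N * p) ^ Suc K)"
    unfolding E_def t_def using pq m by (intro ln_fact_shifted_stirling) real_asymp
  also have "(\<lambda>N. 1 / (real N * p) ^ Suc K) \<in> O(\<lambda>N. 1 / real N ^ Suc K)"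
    by (rule bigoI[where c = "1 / p ^ Suc K"]) (use pq in \<open>simp add: power_mult_distrib mult_ac\<close>)
  finally have E1: "(\<lambda>N. E (m N) (real N * p) (t N)) \<in> O(\<lambda>N. 1 / real N ^ Suc K)" .
  have E0: "(\<lambda>N. E N (real N) 0) \<in> O(\<lambda>N. 1 / real N ^ Suc K)"
    using ln_fact_shifted_stirling[of real "\<lambda>N. N" K] filterlim_real_sequentially
    by (simp add: E_def Bseq_def gt_ex)
  \<comment> \<open>The three Stirling errors are combined as in ln N! - ln m! - ln (N - m)!; by
    \<open>stirling_series_binomial\<close> this is eventually the error of the binomial
    expansion.\<close>
  have "(\<lambda>N. E N (real N) 0 - E (m N) (real N * p) (t N) -
      E (N - m N) (real N * q) (real (N - m N) - real N * q)) \<in> O(\<lambda>N. 1 / real N ^ Suc K)"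
    by (intro sum_in_bigo E0 E1 E2)
  moreover have "eventually (\<lambda>N. E N (real N) 0 - E (m N) (real N * p) (t N) -
      E (N - m N) (real N * q) (real (N - m N) - real N * q) =
      ln (sqrt (2 * pi * real N * p * q) * (real (N choose m N) * p ^ m N * q ^ (N - m N))) -
      (\<Sum>k=1..K. poly (binomial_local_poly p q k) (t N) / real N ^ k)) sequentially"
    using le t' eventually_gt_at_top[of 0]
  proof eventually_elim
    case (elim N)
    have N: "real N > 0"
      using elim by simp
    have shift: "real (m N) = real N * p + t N" "real (N - m N) = real N * q - t N"
      using elim by (simp_all add: t_def)
    have "real (N choose m N) = fact N / (fact (m N) * fact (N - m N))"
      using elim by (simp add: binomial_fact)
    then have "ln (sqrt (2 * pi * real N * p * q) *
          (real (N choose m N) * p ^ m N * q ^ (N - m N))) =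
        ln (2 * pi * real N * p * q) / 2 + (ln (fact N) - (ln (fact (m N)) + ln (fact (N - m N)))) +
        real (m N) * ln p + real (N - m N) * ln q"
      using pq elim by (simp add: ln_mult ln_div ln_realpow ln_sqrt)
    then show ?case
      using stirling_series_binomial[OF pq N, of K "t N"]
      unfolding E_def elim(2) unfolding shift by linarith
  qed
  ultimately show "(\<lambda>N. ln (sqrt (2 * pi * real N * p * q) *
        (real (N choose m N) * p ^ m N * q ^ (N - m N))) -
        (\<Sum>k=1..K. poly (binomial_local_poly p q k) (real (m N) - real N * p) / real N ^ k))
      \<in> O(\<lambda>N. 1 / real N ^ (K + 1))"
    unfolding t_def by (simp add: landau_o.big.in_cong)
qed

section \<open>Uniqueness of the coefficients\<close>

text \<open>By compactness, a limit point of \<open>x\<close> in [j, j + 1] is a root. Roots in all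
  these intervals form an unbounded set, impossible for a nonzero polynomial.\<close>

lemma poly_eq_0_if_vanishing:
  fixes D :: "real poly"
  assumes "\<And>j :: nat. \<exists>x. (\<forall>N :: nat. x N \<in> {real j..real j + 1}) \<and> (\<lambda>N. poly D (x N)) \<longlonglongrightarrow> 0"
  shows "D = 0"
proof (rule ccontr)
  assume "D \<noteq> 0"
  have "\<exists>r. poly D r = 0 \<and> r \<ge> real j" for j
  proof -
    obtain x where x: "\<And>N. x N \<in> {real j..real j + 1}" "(\<lambda>N. poly D (x N)) \<longlonglongrightarrow> 0"
      using assms by blast
    have "compact {real j..real j + 1}"
      by simp
    then obtain r s where r: "r \<in> {real j..real j + 1}" "strict_mono (s :: nat \<Rightarrow> nat)" "(x \<circ> s) \<longlonglongrightarrow> r"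
      using x(1) unfolding compact_def by meson
    have "(\<lambda>N. poly D ((x \<circ> s) N)) \<longlonglongrightarrow> poly D r"
      by (intro tendsto_intros r)
    moreover have "(\<lambda>N. poly D ((x \<circ> s) N)) \<longlonglongrightarrow> 0"
      using LIMSEQ_subseq_LIMSEQ[OF x(2) r(2)] by (simp add: o_def)
    ultimately have "poly D r = 0"
      by (rule LIMSEQ_unique)
    then show ?thesis
      using r(1) by auto
  qed
  then have "\<not> bdd_above {r. poly D r = 0}"
    unfolding bdd_above_def by (smt (verit) mem_Collect_eq reals_Archimedean2)
  with bdd_above_finite[OF poly_roots_finite[OF \<open>D \<noteq> 0\<close>]] show False
    by simp
qed

text \<open>Strong induction on \<open>k\<close>: subtracting the two expansions of order
  \<open>k\<close> removes the mass itself and all lower coefficients. Multiplication by N^k then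
  shows that the difference of the k-th coefficients tends to 0 along each admissible sequence of
  deviations.\<close>

theorem binomial_local_expansion_unique:
  assumes p: "p > 0"
    and A: "binomial_local_expansion p q A" and A': "binomial_local_expansion p q A'"
    and "k \<ge> 1"
  shows "A k = A' k"
  using \<open>k \<ge> 1\<close>
proof (induction k rule: less_induct)
  case (less k)
  have "A k - A' k = 0"
  proof (rule poly_eq_0_if_vanishing)
    fix j :: nat
    \<comment> \<open>Rounding \<open>N p\<close> down loses less than 1, so adding
      \<open>j + 1\<close> puts the deviation between \<open>j\<close> and \<open>j + 1\<close> for
      every \<open>N\<close>.\<close>
    define m where "m N = nat \<lfloor>real N * p\<rfloor> + j + 1" for N
    define t where "t N = real (m N) - real N * p" for N
    have t: "t N \<in> {real j..real j + 1}" for N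
    proof -
      have "real (nat \<lfloor>real N * p\<rfloor>) = of_int \<lfloor>real N * p\<rfloor>"
        using p by simp
      then show ?thesis
        unfolding t_def m_def by (auto, linarith+)
    qed
    have "norm (t N) \<le> real j + 1" for N
      using t[of N] by auto
    then have "Bseq t"
      by (intro BseqI') auto
    define f where "f N = ln (sqrt (2 * pi * real N * p * q) *
      (real (N choose m N) * p ^ m N * q ^ (N - m N)))" for N
    have O: "(\<lambda>N. f N -
          (\<Sum>i=1..k. poly (F i) (t N) / real N ^ i)) \<in> O(\<lambda>N. 1 / real N ^ (k + 1))"
      if "binomial_local_expansion p q F" for F
      using that \<open>Bseq t\<close> unfolding binomial_local_expansion_def t_def[abs_def] f_def[abs_def] by blast
    have "f N - (\<Sum>i=1..k. poly (A' i) (t N) / real N ^ i) -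
        (f N - (\<Sum>i=1..k. poly (A i) (t N) / real N ^ i)) =
        poly (A k - A' k) (t N) / real N ^ k" for N
    proof -
      have "{1..k} = insert k {1..<k}"
        using less.prems by auto
      then show ?thesis
        using less.IH by (simp add: diff_divide_distrib)
    qed
    with sum_in_bigo(2)[OF O[OF A'] O[OF A]]
    have "(\<lambda>N. poly (A k - A' k) (t N) / real N ^ k) \<in> O(\<lambda>N. 1 / real N ^ (k + 1))"
      by (simp only:)
    then have "(\<lambda>N. real N ^ k * (poly (A k - A' k) (t N) / real N ^ k)) \<in>
        O(\<lambda>N. real N ^ k * (1 / real N ^ (k + 1)))"
      by (rule landau_o.big.mult_left)
    also have "(\<lambda>N. real N ^ k * (1 / real N ^ (k + 1))) \<in> o(\<lambda>N. 1)"
      by real_asymp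
    finally have "(\<lambda>N. real N ^ k * (poly (A k - A' k) (t N) / real N ^ k)) \<longlonglongrightarrow> 0"
      by (auto dest: smalloD_tendsto)
    moreover have "eventually (\<lambda>N. real N ^ k * (poly (A k - A' k) (t N) / real N ^ k) =
        poly (A k - A' k) (t N)) sequentially"
      using eventually_gt_at_top[of 0] by eventually_elim simp
    ultimately have "(\<lambda>N. poly (A k - A' k) (t N)) \<longlonglongrightarrow> 0"
      by (rule Lim_transform_eventually)
    with t show "\<exists>x. (\<forall>N :: nat. x N \<in> {real j..real j + 1}) \<and>
        (\<lambda>N. poly (A k - A' k) (x N)) \<longlonglongrightarrow> 0"
      by blast
  qed
  then show ?case
    by simp
qed

section \<open>The coefficients and their closed form\<close>

text \<open>Existence and uniqueness of the expansion together make the definite description in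
  \<open>binomial_local_coeff\<close> well defined.\<close>

lemma binomial_local_coeff_eq:
  assumes "p > 0" "q > 0" "p + q = 1" "k \<ge> 1"
  shows "binomial_local_coeff p q k t = poly (binomial_local_poly p q k) t"
  unfolding binomial_local_coeff_def
proof (rule the_equality)
  show "\<exists>A. binomial_local_expansion p q A \<and> poly (binomial_local_poly p q k) t = poly (A k) t"
    using binomial_local_expansion_poly assms by blast
next
  fix a assume "\<exists>A. binomial_local_expansion p q A \<and> a = poly (A k) t"
  then show "a = poly (binomial_local_poly p q k) t"
    using binomial_local_expansion_unique binomial_local_expansion_poly assms by metis
qed

theorem proposition4p4:
  fixes p q :: real and P t :: "nat \<Rightarrow> real" and k :: nat
  assumes "p > 0" and "q > 0" and "p + q = 1"
    and "P 1 = p" and "P 2 = q"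
    and "t 2 = - t 1"
    and "k \<ge> 1"
  shows "multinomial_local_coeff 2 P t k = binomial_local_coeff p q k (t 1) \<and>
    binomial_local_coeff p q k (t 1) =
      (-1) ^ (k + 1) / (real k * (real k + 1)) *
        (bernoulli (k + 1) - (1 / p ^ k + (-1) ^ (k + 1) * (1 / q ^ k)) * bernpoly (k + 1) (t 1))
      + (-1) ^ k * t 1 ^ k / (real k * p ^ k)"
proof
  have "{1..2} = {1, 2 :: nat}"
    by auto
  then show "multinomial_local_coeff 2 P t k = binomial_local_coeff p q k (t 1)"
    using assms by (simp add: binomial_local_coeff_eq poly_binomial_local_poly
        multinomial_local_coeff_def)
  have shift: "bernpoly (k + 1) (t 1 + 1) = bernpoly (k + 1) (t 1) + (real k + 1) * t 1 ^ k"
    using bernpoly_add_one[of k "t 1"] by (simp add: add.commute)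
  have reflect: "bernpoly (k + 1) (- t 1 + 1) = (-1) ^ (k + 1) * bernpoly (k + 1) (t 1)"
    using bernpoly_reflect[of "k + 1" "t 1"] by simp
  \<comment> \<open>Here \<open>s\<close> stands for (-1)^k, \<open>c\<close> for k and
    \<open>u\<close> for the k-th power of \<open>t 1\<close>. The difference term (k + 1)u,
    multiplied by the prefactor, becomes the separate last summand of the closed form.\<close>
  have alg: "- s / (c * (c + 1)) * (b - (1 / x * (B + (c + 1) * u) + 1 / y * (- s * B))) =
      - s / (c * (c + 1)) * (b - (1 / x + - s * (1 / y)) * B) + s * u / (c * x)"
    if "c > 0" "x > 0" "y > 0" for s c b x y B u :: real
    using that by (simp add: divide_simps) (simp add: algebra_simps)
  show "binomial_local_coeff p q k (t 1) =
      (-1) ^ (k + 1) / (real k * (real k + 1)) *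
        (bernoulli (k + 1) - (1 / p ^ k + (-1) ^ (k + 1) * (1 / q ^ k)) * bernpoly (k + 1) (t 1))
      + (-1) ^ k * t 1 ^ k / (real k * p ^ k)"
    unfolding binomial_local_coeff_eq[OF assms(1-3,7)] poly_binomial_local_poly shift reflect
    using alg[of "real k" "p ^ k" "q ^ k" "(-1) ^ k"] assms by simp
qed

end
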